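(* Let $A,B$ be real symmetric $4\times 4$ matrices defining quadrics $\mathcal A: X^TAX=0$, $\mathcal B: X^TBX=0$ in $\mathbb{PR}^3$ with $f(\lambda)=\det(\lambda A-B)$ not identically zero. If $f(\lambda)=0$ has two distinct pairs of complex conjugate roots, then the Segre characteristic is $[1111]$ and the index sequence is $\langle 2\rangle$. In this case the QSIC $\mathcal A\cap\mathcal B$ comprises two open components in $\mathbb{PR}^3$.
   Context: $X=(x,y,z,w)^T$ are homogeneous coordinates. One may choose the basis of the pencil with $A$ nonsingular. Segre characteristic: the list of the sizes of the Jordan blocks of $A^{-1}B$ over all (real and complex) eigenvalues, sizes of blocks belonging to the same eigenvalue grouped in round parentheses; $[1111]$ means four distinct eigenvalues each with a $1\times1$ block. $\mathrm{Id}(\lambda)$ is the number of positive eigenvalues of $\lambda A-B$; when $f$ has no real root the index sequence is $\langle s_0\rangle$ with $s_0$ the constant value of $\mathrm{Id}$ on $\mathbb R$. A real connected component of the QSIC is open if it meets every real plane of $\mathbb{PR}^3$ and closed otherwise. *)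

theory Defs
  imports "HOL-Analysis.Analysis" "HOL-Computational_Algebra.Polynomial"
begin

definition pencil_poly :: "real^4^4 \<Rightarrow> real^4^4 \<Rightarrow> real poly" where
  "pencil_poly A B = det (\<chi> i j. [: - (B$i$j), A$i$j :])"

definition char_poly4 :: "real^4^4 \<Rightarrow> real poly" where
  "char_poly4 M = det (\<chi> i j. (if i = j then [:0, 1:] else 0) - [: M$i$j :])"

definition num_pos_eig :: "real^4^4 \<Rightarrow> nat" where
  "num_pos_eig M = (\<Sum>r\<in>{r::real. r > 0 \<and> poly (char_poly4 M) r = 0}. order r (char_poly4 M))"

definition Id_pencil :: "real^4^4 \<Rightarrow> real^4^4 \<Rightarrow> real \<Rightarrow> nat" where
  "Id_pencil A B l = num_pos_eig (l *\<^sub>R A - B)"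

definition index_seq_const :: "real^4^4 \<Rightarrow> real^4^4 \<Rightarrow> nat \<Rightarrow> bool" where
  "index_seq_const A B s \<longleftrightarrow>
     (\<forall>l::real. poly (pencil_poly A B) l \<noteq> 0) \<and> (\<forall>l::real. Id_pencil A B l = s)"

definition cmat :: "real^4^4 \<Rightarrow> complex^4^4" where
  "cmat M = (\<chi> i j. complex_of_real (M$i$j))"

definition cdiag :: "complex^4 \<Rightarrow> complex^4^4" where
  "cdiag \<mu> = (\<chi> i j. if i = j then \<mu>$i else 0)"

text \<open>Segre characteristic [1111]: A is nonsingular and the Jordan form of A^{-1}B
  (over the complex numbers) consists of four 1x1 blocks with four distinct eigenvalues.\<close>
definition segre_1111 :: "real^4^4 \<Rightarrow> real^4^4 \<Rightarrow> bool" where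
  "segre_1111 A B \<longleftrightarrow> invertible A \<and>
     (\<exists>P::complex^4^4. \<exists>\<mu>::complex^4. invertible P \<and> inj (\<lambda>i. \<mu>$i) \<and>
        matrix_inv P ** cmat (matrix_inv A ** B) ** P = cdiag \<mu>)"

definition proj_pt :: "real^4 \<Rightarrow> (real^4) set" where
  "proj_pt x = {c *\<^sub>R x | c. c \<noteq> 0}"

definition PR3 :: "(real^4) set set" where
  "PR3 = proj_pt ` (- {0})"

text \<open>Quotient topology on PR^3 induced by R^4 minus the origin.\<close>
definition PR3_topology :: "(real^4) set topology" where
  "PR3_topology = topology (\<lambda>U. U \<subseteq> PR3 \<and> open (\<Union>U))"

definition proj_plane :: "real^4 \<Rightarrow> (real^4) set set" where
  "proj_plane a = {p \<in> PR3. \<exists>x\<in>p. a \<bullet> x = 0}"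

definition proj_quadric :: "real^4^4 \<Rightarrow> (real^4) set set" where
  "proj_quadric A = {p \<in> PR3. \<forall>x\<in>p. x \<bullet> (A *v x) = 0}"

definition QSIC :: "real^4^4 \<Rightarrow> real^4^4 \<Rightarrow> (real^4) set set" where
  "QSIC A B = proj_quadric A \<inter> proj_quadric B"

definition QSIC_components :: "real^4^4 \<Rightarrow> real^4^4 \<Rightarrow> (real^4) set set set" where
  "QSIC_components A B = connected_components_of (subtopology PR3_topology (QSIC A B))"

definition open_component :: "(real^4) set set \<Rightarrow> bool" where
  "open_component K \<longleftrightarrow> (\<forall>a::real^4. a \<noteq> 0 \<longrightarrow> K \<inter> proj_plane a \<noteq> {})"

end

theory Submission
  imports Defs "HOL-Computational_Algebra.Fundamental_Theorem_Algebra"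
begin

text \<open>Four distinct nonreal roots force \<open>A\<close> to be nonsingular and give a complex eigenbasis
  \<open>u, cnj u, v, cnj v\<close> of the pencil in which \<open>A\<close> becomes the identity and \<open>B\<close> becomes
  \<open>diag(x, cnj x, y, cnj y)\<close>, where \<open>Im x\<close> and \<open>Im y\<close> may be taken positive. In the real coordinates
  \<open>(a, b) \<in> C \<times> C\<close> of a vector the two quadratic forms are \<open>2 Re (a\<^sup>2 + b\<^sup>2)\<close> and
  \<open>2 Re (x a\<^sup>2 + y b\<^sup>2)\<close>.

  The determinant of \<open>\<lambda>A - B\<close> is always positive, so the number of its positive eigenvalues is even,
  and it is neither 0 nor 4 because \<open>\<lambda>A - B\<close> has an isotropic vector.

  The intersection curve is \<open>a\<^sup>2 = \<alpha> b\<^sup>2 + \<beta> cnj b\<^sup>2\<close> with \<open>|\<beta>| < |\<alpha>|\<close>, since \<open>Im x\<close> and \<open>Im y\<close>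
  have the same sign. The right-hand side has a continuous square root \<open>s b\<close> that is odd and vanishes
  nowhere on the punctured plane, so the curve splits into the two connected pieces \<open>a = s b\<close> and
  \<open>a = - s b\<close>. A linear form restricted to either piece is an odd function of \<open>b\<close> and hence has a zero.\<close>

subsection \<open>Determinants of matrix pencils\<close>

lemma poly_map_of_real_add:
  "poly (map_poly complex_of_real (p + q)) z =
   poly (map_poly complex_of_real p) z + poly (map_poly complex_of_real q) z"
proof -
  have "map_poly complex_of_real (p + q) = map_poly complex_of_real p + map_poly complex_of_real q"
    by (rule poly_eqI) (simp add: coeff_map_poly)
  then show ?thesis by simp
qed

lemma poly_map_of_real_mult:
  "poly (map_poly complex_of_real (p * q)) z =
   poly (map_poly complex_of_real p) z * poly (map_poly complex_of_real q) z"
proof (induction p)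
  case (pCons a p)
  have "poly (map_poly complex_of_real (smult a q)) z = of_real a * poly (map_poly complex_of_real q) z"
    by (simp add: map_poly_smult)
  with pCons show ?case
    by (simp add: poly_map_of_real_add map_poly_pCons algebra_simps)
qed simp

lemma poly_map_of_real_sum:
  "poly (map_poly complex_of_real (sum f S)) z = (\<Sum>i\<in>S. poly (map_poly complex_of_real (f i)) z)"
  by (induction S rule: infinite_finite_induct) (auto simp: poly_map_of_real_add)

lemma poly_map_of_real_prod:
  "poly (map_poly complex_of_real (prod f S)) z = (\<Prod>i\<in>S. poly (map_poly complex_of_real (f i)) z)"
  by (induction S rule: infinite_finite_induct) (auto simp: poly_map_of_real_mult)

lemma poly_map_of_real_of_int:
  "poly (map_poly complex_of_real (of_int k)) z = of_int k"
  by (simp add: of_int_poly map_poly_pCons)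

text \<open>Evaluation at a complex point respects sums and products, so it passes through the
  Leibniz formula. This turns complex roots of \<open>pencil_poly\<close> into singular complex
  matrices.\<close>

lemma poly_map_of_real_det:
  fixes Q :: "real poly^'n^'n"
  shows "poly (map_poly complex_of_real (det Q)) z =
         det (\<chi> i j. poly (map_poly complex_of_real (Q$i$j)) z)"
  by (simp add: det_def poly_map_of_real_sum poly_map_of_real_mult poly_map_of_real_prod
      poly_map_of_real_of_int)

lemma poly_det:
  fixes Q :: "real poly^'n^'n"
  shows "poly (det Q) x = det (\<chi> i j. poly (Q$i$j) x)"
  by (simp add: det_def poly_sum poly_prod)


definition cpencil :: "complex \<Rightarrow> real^4^4 \<Rightarrow> real^4^4 \<Rightarrow> complex^4^4" where
  "cpencil z A B = (\<chi> i j. z * of_real (A$i$j) - of_real (B$i$j))"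

lemma poly_pencil_poly_complex:
  "poly (map_poly complex_of_real (pencil_poly A B)) z = det (cpencil z A B)"
  by (simp add: pencil_poly_def poly_map_of_real_det cpencil_def map_poly_pCons)

lemma poly_pencil_poly: "poly (pencil_poly A B) x = det (x *\<^sub>R A - B)"
proof -
  have "(\<chi> i j. poly ((\<chi> i j. [: - (B$i$j), A$i$j :])$i$j) x) = x *\<^sub>R A - B"
    by (simp add: vec_eq_iff)
  then show ?thesis by (simp only: pencil_poly_def poly_det)
qed

lemma cpencil_mult_vec: "cpencil z A B *v v = z *s (cmat A *v v) - cmat B *v v"
  by (simp add: cpencil_def cmat_def vec_eq_iff matrix_vector_mult_def sum_subtractf
      sum_distrib_left algebra_simps)

text \<open>A root makes \<open>cpencil z A B\<close> singular, and a kernel vector is a generalized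
  eigenvector. With \<open>A = mat 1\<close> the same lemma later supplies ordinary
  eigenvectors.\<close>

lemma pencil_root_eigenvector:
  assumes "poly (map_poly complex_of_real (pencil_poly A B)) z = 0"
  obtains v where "v \<noteq> 0" "cmat B *v v = z *s (cmat A *v v)"
proof -
  have "\<not> invertible (cpencil z A B)"
    using assms by (simp add: poly_pencil_poly_complex invertible_det_nz)
  then have "\<not> (\<exists>C. C ** cpencil z A B = mat 1)"
    by (simp add: invertible_left_inverse)
  then obtain v where "cpencil z A B *v v = 0" "v \<noteq> 0"
    by (auto simp: matrix_left_invertible_ker)
  then show thesis using that by (simp add: cpencil_mult_vec)
qed

text \<open>Meant for the Leibniz products of a pencil, where it extracts the product of the entries
  of \<open>A\<close>. Some factors may be constant, hence the coefficient at \<open>card S\<close>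
  instead of the leading one.\<close>

lemma coeff_prod_degree_le_1:
  fixes q :: "'a \<Rightarrow> real poly"
  assumes "finite S" "\<And>i. i \<in> S \<Longrightarrow> degree (q i) \<le> 1"
  shows "coeff (prod q S) (card S) = (\<Prod>i\<in>S. coeff (q i) 1)"
  using assms
proof (induction S)
  case (insert i S)
  have "degree (prod q S) \<le> sum (degree \<circ> q) S"
    by (rule degree_prod_sum_le) (use insert in auto)
  also have "\<dots> \<le> (\<Sum>i\<in>S. 1)" by (rule sum_mono) (use insert in auto)
  finally have "degree (prod q S) \<le> card S" by simp
  then have "coeff (prod q S) (Suc (card S)) = 0" by (simp add: coeff_eq_0)
  moreover have "q i = [:coeff (q i) 0, coeff (q i) 1:]"
    using insert.prems[of i] by (intro poly_eqI) (auto simp: coeff_pCons coeff_eq_0 split: nat.split)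
  then obtain a b where "q i = [:a, b:]" by blast
  ultimately have "coeff (q i * prod q S) (Suc (card S)) = coeff (q i) 1 * coeff (prod q S) (card S)"
    by simp
  then show ?case using insert by simp
qed auto

lemma degree_pencil_poly_le: "degree (pencil_poly A B) \<le> 4"
  unfolding pencil_poly_def det_def
proof (rule degree_sum_le)
  fix p :: "4 \<Rightarrow> 4"
  let ?q = "\<lambda>i. [: - (B$i$p i), A$i$p i :]"
  have "degree (prod ?q UNIV) \<le> sum (degree \<circ> ?q) UNIV"
    by (rule degree_prod_sum_le) auto
  also have "\<dots> \<le> (\<Sum>i\<in>(UNIV::4 set). 1)" by (rule sum_mono) auto
  finally have "degree (prod ?q UNIV) \<le> 4" by simp
  then have "degree (of_int (sign p) * prod ?q UNIV) \<le> 4"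
    by (metis (no_types, lifting) add_0 degree_mult_le degree_of_int order_trans)
  then show "degree (of_int (sign p) *
      (\<Prod>i\<in>UNIV. (\<chi> i j. [: - (B$i$j), A$i$j :]) $ i $ p i)) \<le> 4" by simp
qed auto

lemma coeff_pencil_poly_4: "coeff (pencil_poly A B) 4 = det A"
proof -
  have "coeff (of_int (sign p) * (\<Prod>i\<in>UNIV. (\<chi> i j. [: - (B$i$j), A$i$j :]) $ i $ p i)) 4
      = of_int (sign p) * (\<Prod>i\<in>UNIV. A$i$p i)" for p :: "4 \<Rightarrow> 4"
    using coeff_prod_degree_le_1[of UNIV "\<lambda>i. [: - (B$i$p i), A$i$p i :]"]
    by (simp add: of_int_poly)
  then show ?thesis by (simp add: pencil_poly_def det_def coeff_sum)
qed

text \<open>The two roots and their conjugates are four distinct roots of a polynomial of degree at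
  most 4. So the degree is exactly 4, and the coefficient there is \<open>det A\<close>.\<close>

lemma four_roots_imp_invertible:
  assumes "pencil_poly A B \<noteq> 0"
    and "Im z1 \<noteq> 0" "Im z2 \<noteq> 0" "z1 \<noteq> z2" "z1 \<noteq> cnj z2"
    and r: "poly (map_poly complex_of_real (pencil_poly A B)) z1 = 0"
      "poly (map_poly complex_of_real (pencil_poly A B)) z2 = 0"
  shows "invertible A"
proof -
  let ?p = "map_poly complex_of_real (pencil_poly A B)"
  have p0: "?p \<noteq> 0" using assms(1) by (simp add: map_poly_eq_0_iff)
  have "cnj z1 \<noteq> z2" "cnj z1 \<noteq> cnj z2" "z1 \<noteq> cnj z1" "z2 \<noteq> cnj z2" "cnj z1 \<noteq> z1" "cnj z2 \<noteq> z2"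
    using assms by (auto simp: complex_eq_iff)
  then have "card {z1, cnj z1, z2, cnj z2} = 4" using assms by auto
  moreover have "{z1, cnj z1, z2, cnj z2} \<subseteq> {z. poly ?p z = 0}"
    using r real_poly_cnj_root_iff[of ?p z1] real_poly_cnj_root_iff[of ?p z2]
    by (auto simp: coeff_map_poly)
  ultimately have "4 \<le> card {z. poly ?p z = 0}"
    using card_mono[OF poly_roots_finite[OF p0]] by metis
  also have "\<dots> \<le> degree ?p" by (rule card_poly_roots_bound[OF p0])
  also have "\<dots> = degree (pencil_poly A B)" by (rule map_poly_degree_eq) (use assms(1) in simp)
  finally have "degree (pencil_poly A B) = 4" using degree_pencil_poly_le[of A B] by simp
  then have "det A \<noteq> 0" using assms(1) coeff_pencil_poly_4[of A B] leading_coeff_0_iff by metis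
  then show ?thesis by (simp add: invertible_det_nz)
qed

subsection \<open>A conjugation-invariant eigenbasis of the pencil\<close>

lemma eigenvectors_independent:
  fixes M :: "complex^'n^'n" and v :: "'i \<Rightarrow> complex^'n"
  assumes "finite S" "inj_on \<mu> S"
    and "\<And>i. i \<in> S \<Longrightarrow> v i \<noteq> 0" "\<And>i. i \<in> S \<Longrightarrow> M *v v i = \<mu> i *s v i"
    and "(\<Sum>i\<in>S. c i *s v i) = 0" "i \<in> S"
  shows "c i = 0"
  using assms
proof (induction S arbitrary: c i)
  case (insert j S)
  \<comment> \<open>Applying \<open>M - \<mu> j\<close> to the relation kills the new vector and
    multiplies each other coefficient by the nonzero number \<open>\<mu> i - \<mu> j\<close>, which
    leaves a relation over \<open>S\<close>.\<close>
  have "0 = M *v (\<Sum>i\<in>insert j S. c i *s v i) - \<mu> j *s (\<Sum>i\<in>insert j S. c i *s v i)"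
    using insert.prems by simp
  also have "\<dots> = (\<Sum>i\<in>insert j S. M *v (c i *s v i) - \<mu> j *s (c i *s v i))"
    by (simp add: vec.linear_sum[OF matrix_vector_mul_linear_gen] vec.scale_sum_right sum_subtractf)
  also have "\<dots> = (\<Sum>i\<in>insert j S. (c i * (\<mu> i - \<mu> j)) *s v i)"
    by (rule sum.cong) (use insert.prems in \<open>auto simp: vec.scale algebra_simps
        vec_eq_iff matrix_vector_mult_scaleR vector_scalar_commute\<close>)
  also have "\<dots> = (\<Sum>i\<in>S. (c i * (\<mu> i - \<mu> j)) *s v i)" using insert by simp
  finally have z: "(\<Sum>i\<in>S. (c i * (\<mu> i - \<mu> j)) *s v i) = 0" by simp
  have "c i * (\<mu> i - \<mu> j) = 0" if "i \<in> S" for i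
    by (rule insert.IH[where c="\<lambda>i. c i * (\<mu> i - \<mu> j)"]) (use insert.prems z that in auto)
  then have cS: "c i = 0" if "i \<in> S" for i
    using that insert.prems(1) insert.hyps by (auto simp: inj_on_def)
  have "(\<Sum>i\<in>S. c i *s v i) = 0" by (rule sum.neutral) (use cS in auto)
  then have "c j *s v j = 0" using insert by simp
  then have "c j = 0" using insert.prems(2)[of j] by auto
  then show ?case using cS insert.prems by auto
qed simp

text \<open>Bilinear, with no conjugation in either slot: it fits congruence by the transpose and
  makes eigenvectors for conjugate eigenvalues orthogonal too.\<close>

definition cbil :: "complex^4^4 \<Rightarrow> complex^4 \<Rightarrow> complex^4 \<Rightarrow> complex" where
  "cbil M u v = (\<Sum>k\<in>UNIV. u$k * (M *v v)$k)"

lemma cbil_scale: "cbil M (a *s u) (b *s v) = a * b * cbil M u v"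
  by (simp add: cbil_def sum_distrib_left vector_scalar_commute mult_ac)

lemma cbil_commute:
  assumes "transpose M = M"
  shows "cbil M u v = cbil M v u"
proof -
  have "M$i$j = M$j$i" for i j
    using arg_cong[OF assms, of "\<lambda>N. N$i$j"] by (simp add: transpose_def)
  then have "(\<Sum>k\<in>UNIV. \<Sum>l\<in>UNIV. u$k * (M$k$l * v$l)) = (\<Sum>k\<in>UNIV. \<Sum>l\<in>UNIV. v$l * (M$l$k * u$k))"
    by (intro sum.cong refl) (metis mult.assoc mult.commute)
  also have "\<dots> = (\<Sum>k\<in>UNIV. \<Sum>l\<in>UNIV. v$k * (M$k$l * u$l))" by (rule sum.swap)
  finally show ?thesis by (simp add: cbil_def matrix_vector_mult_def sum_distrib_left)
qed

lemma transpose_mult_vec_nth: "(transpose V *v w)$j = (\<Sum>k\<in>UNIV. column j V $ k * w$k)"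
  by (simp add: matrix_vector_mult_def transpose_def column_def)

lemma congruence_entry:
  "(transpose V ** M ** V)$i$j = cbil M (column i V) (column j V)"
proof -
  have "(transpose V ** M ** V)$i$j = (transpose V ** (M ** V))$i$j"
    by (simp add: matrix_mul_assoc)
  then show ?thesis
    by (simp add: matrix_matrix_mult_def cbil_def transpose_def column_def matrix_vector_mult_def)
qed

lemma transpose_cmat: "transpose A = A \<Longrightarrow> transpose (cmat A) = cmat A"
  by (simp add: cmat_def transpose_def vec_eq_iff)

lemma cmat_mult: "cmat (A ** B) = cmat A ** cmat B"
  by (simp add: cmat_def matrix_matrix_mult_def vec_eq_iff)

lemma cmat_1: "cmat (mat 1) = mat 1"
  by (simp add: cmat_def mat_def vec_eq_iff)

text \<open>By symmetry the \<open>B\<close>-form of \<open>u\<close> and \<open>v\<close> equals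
  both \<open>x\<close> and \<open>y\<close> times their \<open>A\<close>-form.\<close>

lemma eigenvectors_orthogonal:
  assumes "transpose A = A" "transpose B = B"
    and u: "cmat B *v u = x *s (cmat A *v u)" and v: "cmat B *v v = y *s (cmat A *v v)"
    and "x \<noteq> y"
  shows "cbil (cmat A) u v = 0"
proof -
  have "y * cbil (cmat A) u v = cbil (cmat B) u v"
    by (simp add: cbil_def v sum_distrib_left mult_ac)
  also have "\<dots> = cbil (cmat B) v u" by (rule cbil_commute) (simp add: transpose_cmat assms)
  also have "\<dots> = x * cbil (cmat A) v u"
    by (simp add: cbil_def u sum_distrib_left mult_ac)
  also have "cbil (cmat A) v u = cbil (cmat A) u v"
    by (rule cbil_commute) (simp add: transpose_cmat assms)
  finally show ?thesis using \<open>x \<noteq> y\<close> by simp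
qed

definition vcnj :: "complex^4 \<Rightarrow> complex^4" where
  "vcnj v = (\<chi> i. cnj (v$i))"

lemma cmat_mult_vcnj: "cmat A *v vcnj v = vcnj (cmat A *v v)"
  by (simp add: cmat_def vcnj_def matrix_vector_mult_def vec_eq_iff)

lemma vcnj_scale: "vcnj (c *s v) = cnj c *s vcnj v"
  by (simp add: vcnj_def vec_eq_iff)

lemma cbil_vcnj: "cbil (cmat A) (vcnj u) (vcnj v) = cnj (cbil (cmat A) u v)"
  by (simp only: cbil_def cmat_mult_vcnj) (simp add: vcnj_def)

text \<open>The columns are permuted by complex conjugation, so in such a basis a real vector is
  given by two complex coordinates together with their conjugates.\<close>

definition conj_frame :: "complex^4 \<Rightarrow> complex^4 \<Rightarrow> complex^4^4" where
  "conj_frame u v = (\<chi> k j. if j = 1 then u$k else if j = 2 then cnj (u$k) else if j = 3 then v$k else cnj (v$k))"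

definition conj_pairs :: "complex \<Rightarrow> complex \<Rightarrow> complex^4" where
  "conj_pairs x y = (\<chi> j. if j = 1 then x else if j = 2 then cnj x else if j = 3 then y else cnj y)"

lemma column_conj_frame [simp]:
  "column 1 (conj_frame u v) = u" "column 2 (conj_frame u v) = vcnj u"
  "column 3 (conj_frame u v) = v" "column 4 (conj_frame u v) = vcnj v"
  by (simp_all add: column_def conj_frame_def vcnj_def vec_eq_iff)

lemma conj_pairs_nth [simp]:
  "conj_pairs x y $ 1 = x" "conj_pairs x y $ 2 = cnj x"
  "conj_pairs x y $ 3 = y" "conj_pairs x y $ 4 = cnj y"
  by (simp_all add: conj_pairs_def)

text \<open>\<open>x\<close> and \<open>y\<close> lie in the upper half plane and their conjugates
  in the lower one.\<close>

lemma inj_conj_pairs: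
  assumes "Im x > 0" "Im y > 0" "x \<noteq> y"
  shows "inj (\<lambda>i. conj_pairs x y $ i)"
proof -
  have "\<forall>i j. conj_pairs x y $ i = conj_pairs x y $ j \<longrightarrow> i = j"
    using assms by (simp add: forall_4) (auto simp: complex_eq_iff)
  then show ?thesis by (auto simp: inj_def)
qed

lemma conj_frame_eigen:
  assumes "cmat B *v u = x *s (cmat A *v u)" "cmat B *v v = y *s (cmat A *v v)"
  shows "cmat B *v column j (conj_frame u v) = conj_pairs x y $ j *s (cmat A *v column j (conj_frame u v))"
proof -
  have "\<forall>j. cmat B *v column j (conj_frame u v) = conj_pairs x y $ j *s (cmat A *v column j (conj_frame u v))"
    using assms by (simp add: forall_4 cmat_mult_vcnj vcnj_scale)
  then show ?thesis by blast
qed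

lemma conj_frame_column_nz:
  assumes "u \<noteq> 0" "v \<noteq> 0"
  shows "column j (conj_frame u v) \<noteq> 0"
proof -
  have "\<forall>j. column j (conj_frame u v) \<noteq> 0"
    using assms by (simp add: forall_4) (simp add: vcnj_def vec_eq_iff)
  then show ?thesis by blast
qed

lemma invertible_cmat: "invertible A \<Longrightarrow> invertible (cmat A)"
  unfolding invertible_def by (metis cmat_mult cmat_1)

text \<open>An isotropic eigenvector would be \<open>A\<close>-orthogonal to the whole eigenbasis,
  so \<open>A\<close> would send it to 0 although \<open>A\<close> is invertible. The lemma is what
  allows eigenvectors to be normalized.\<close>

lemma eigenvector_bilinear_nz:
  assumes A: "invertible A" and sym: "transpose A = A" "transpose B = B"
    and eu: "cmat B *v u = x *s (cmat A *v u)" and ev: "cmat B *v v = y *s (cmat A *v v)"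
    and nz: "u \<noteq> 0" "v \<noteq> 0" and im: "Im x > 0" "Im y > 0" "x \<noteq> y"
  shows "cbil (cmat A) (column j (conj_frame u v)) (column j (conj_frame u v)) \<noteq> 0"
proof
  let ?W = "conj_frame u v" and ?\<mu> = "conj_pairs x y"
  note inj = inj_conj_pairs[OF im]
  obtain C where C: "C ** cmat A = mat 1"
    using invertible_cmat[OF A] by (auto simp: invertible_def)
  have CA: "C *v (cmat A *v w) = w" for w
    by (simp add: matrix_vector_mul_assoc C)
  have "(C ** cmat B) *v column j ?W = ?\<mu>$j *s column j ?W" for j
    by (simp add: matrix_vector_mul_assoc[symmetric] conj_frame_eigen[OF eu ev] vector_scalar_commute CA)
  then have ind: "c j = 0" if "(\<Sum>i\<in>UNIV. c i *s column i ?W) = 0" for c :: "4 \<Rightarrow> complex" and j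
    using eigenvectors_independent[of UNIV "\<lambda>i. ?\<mu>$i" "\<lambda>i. column i ?W" "C ** cmat B" c j]
      that inj conj_frame_column_nz[OF nz] by auto
  have ker: "c = 0" if "?W *v c = 0" for c
    using ind[of "\<lambda>i. c$i"] that by (simp add: matrix_mult_sum vec_eq_iff)
  have "invertible ?W"
    using ker by (auto simp: invertible_left_inverse matrix_left_invertible_ker)
  then have "invertible (transpose ?W)" by (simp add: invertible_det_nz det_transpose)
  then have kerT: "c = 0" if "transpose ?W *v c = 0" for c
    using that by (auto simp: invertible_left_inverse matrix_left_invertible_ker)
  assume d: "cbil (cmat A) (column j ?W) (column j ?W) = 0"
  have "cbil (cmat A) (column i ?W) (column j ?W) = 0" for i
  proof (cases "i = j")
    case False
    then have "?\<mu>$i \<noteq> ?\<mu>$j" using inj by (auto simp: inj_def)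
    then show ?thesis using eigenvectors_orthogonal[OF sym] conj_frame_eigen[OF eu ev] by blast
  qed (use d in simp)
  then have "transpose ?W *v (cmat A *v column j ?W) = 0"
    by (simp only: vec_eq_iff transpose_mult_vec_nth cbil_def zero_index simp_thms)
  then have "cmat A *v column j ?W = 0" by (rule kerT)
  then have "column j ?W = 0" using CA by (metis matrix_vector_mult_0_right)
  then show False using conj_frame_column_nz[OF nz] by blast
qed

lemma pencil_eigenbasis:
  fixes A B :: "real^4^4"
  assumes sym: "transpose A = A" "transpose B = B" and A: "invertible A"
    and im: "Im x > 0" "Im y > 0" "x \<noteq> y"
    and r: "poly (map_poly complex_of_real (pencil_poly A B)) x = 0"
      "poly (map_poly complex_of_real (pencil_poly A B)) y = 0"
  obtains u v where "transpose (conj_frame u v) ** cmat A ** conj_frame u v = mat 1"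
    "transpose (conj_frame u v) ** cmat B ** conj_frame u v = cdiag (conj_pairs x y)"
proof -
  obtain u0 v0 where uv0: "u0 \<noteq> 0" "v0 \<noteq> 0"
    "cmat B *v u0 = x *s (cmat A *v u0)" "cmat B *v v0 = y *s (cmat A *v v0)"
    using pencil_root_eigenvector r by metis
  define d e where "d = cbil (cmat A) u0 u0" and "e = cbil (cmat A) v0 v0"
  have de: "d \<noteq> 0" "e \<noteq> 0"
    using eigenvector_bilinear_nz[OF A sym uv0(3,4,1,2) im, of 1]
      eigenvector_bilinear_nz[OF A sym uv0(3,4,1,2) im, of 3] by (auto simp: d_def e_def)
  \<comment> \<open>Over the complex numbers a nonzero value of a bilinear form can be scaled to 1
    by a square root, whatever its argument. The conjugate columns are then normalized as
    well.\<close>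
  define u v where "u = (1 / csqrt d) *s u0" and "v = (1 / csqrt e) *s v0"
  have eu: "cmat B *v u = x *s (cmat A *v u)" and ev: "cmat B *v v = y *s (cmat A *v v)"
    using uv0 by (simp_all add: u_def v_def vector_scalar_commute vec.scale_left_commute)
  have "csqrt d * csqrt d = d" "csqrt e * csqrt e = e"
    by (metis power2_csqrt power2_eq_square)+
  then have n: "cbil (cmat A) u u = 1" "cbil (cmat A) v v = 1"
    using de by (simp_all add: u_def v_def cbil_scale flip: d_def e_def)
  let ?W = "conj_frame u v" and ?\<mu> = "conj_pairs x y"
  have diag: "\<forall>j. cbil (cmat A) (column j ?W) (column j ?W) = 1"
    using n by (simp add: forall_4 cbil_vcnj)
  have off: "cbil (cmat A) (column i ?W) (column j ?W) = 0" if "i \<noteq> j" for i j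
  proof -
    have "?\<mu>$i \<noteq> ?\<mu>$j" using inj_conj_pairs[OF im] that by (auto simp: inj_def)
    then show ?thesis using eigenvectors_orthogonal[OF sym] conj_frame_eigen[OF eu ev] by blast
  qed
  have b: "cbil (cmat B) (column i ?W) (column j ?W) = ?\<mu>$j * cbil (cmat A) (column i ?W) (column j ?W)" for i j
    by (simp add: cbil_def conj_frame_eigen[OF eu ev] sum_distrib_left mult_ac)
  show thesis
  proof
    show "transpose ?W ** cmat A ** ?W = mat 1"
      using diag off by (simp add: vec_eq_iff congruence_entry mat_def)
    show "transpose ?W ** cmat B ** ?W = cdiag ?\<mu>"
      using diag off by (simp add: vec_eq_iff congruence_entry cdiag_def b)
  qed
qed

lemma cmat_pencil_congruence:
  fixes V :: "complex^4^4"
  assumes "transpose V ** cmat A ** V = mat 1" "transpose V ** cmat B ** V = cdiag \<mu>"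
  shows "transpose V ** cmat (l *\<^sub>R A - B) ** V = cdiag (\<chi> j. of_real l - \<mu>$j)"
proof -
  have "cbil (cmat (l *\<^sub>R A - B)) u v = of_real l * cbil (cmat A) u v - cbil (cmat B) u v" for u v
    by (simp add: cbil_def cmat_def matrix_vector_mult_def sum_subtractf sum_distrib_left algebra_simps)
  then have "(transpose V ** cmat (l *\<^sub>R A - B) ** V)$i$j =
      of_real l * (transpose V ** cmat A ** V)$i$j - (transpose V ** cmat B ** V)$i$j" for i j
    by (simp add: congruence_entry)
  then show ?thesis
    by (simp add: assms vec_eq_iff mat_def cdiag_def)
qed

section \<open>Positivity of the determinant, and the Segre characteristic\<close>

lemma det_cmat: "det (cmat M) = of_real (det M)"
  by (simp add: det_def cmat_def)

lemma invertible_of_congruence: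
  fixes V :: "complex^4^4"
  assumes "transpose V ** cmat A ** V = mat 1"
  shows "invertible V"
  using assms unfolding invertible_left_inverse by blast

text \<open>Conjugation exchanges columns 1, 2 and columns 3, 4. This is an even permutation, so the
  determinant is real and its square will be positive.\<close>

lemma cnj_det_conj_frame: "cnj (det (conj_frame u v)) = det (conj_frame u v)"
proof -
  define p :: "4 \<Rightarrow> 4" where "p = Transposition.transpose 1 2 \<circ> Transposition.transpose 3 4"
  have p: "p permutes UNIV" unfolding p_def
    by (intro permutes_compose permutes_swap_id) auto
  have s: "sign p = 1" unfolding p_def
    by (simp add: sign_compose sign_swap_id permutation_swap_id)
  have p_eq: "p 1 = 2" "p 2 = 1" "p 3 = 4" "p 4 = 3"
    by (simp_all add: p_def Transposition.transpose_def)
  have "\<forall>j. cnj (conj_frame u v $ i $ j) = conj_frame u v $ i $ p j" for i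
    by (simp add: forall_4 p_eq conj_frame_def)
  then have "cnj (det (conj_frame u v)) = det (\<chi> i j. conj_frame u v $ i $ p j)"
    by (simp add: det_def)
  then show ?thesis using det_permute_columns[OF p, of "conj_frame u v"] s by simp
qed

lemma prod_4: "prod f (UNIV::4 set) = f 1 * f 2 * f 3 * (f 4 :: 'a :: comm_monoid_mult)"
  unfolding UNIV_4 by (simp add: ac_simps)

lemma matrix_inv_right: "invertible A \<Longrightarrow> A ** matrix_inv A = mat 1"
  unfolding invertible_def matrix_inv_def by (rule someI2_ex) auto

text \<open>Taking determinants in the congruence gives
  \<open>r\<^sup>2 * det (l *\<^sub>R A - B)\<close> on one side and the product of the squared
  distances from \<open>l\<close> to \<open>x\<close> and \<open>y\<close> on the other, where
  \<open>r\<close> is the real determinant of the frame.\<close>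

lemma det_pencil_pos:
  fixes A B :: "real^4^4"
  assumes VA: "transpose (conj_frame u v) ** cmat A ** conj_frame u v = mat 1"
    and VB: "transpose (conj_frame u v) ** cmat B ** conj_frame u v = cdiag (conj_pairs x y)"
    and im: "Im x \<noteq> 0" "Im y \<noteq> 0"
  shows "det (l *\<^sub>R A - B) > 0"
proof -
  let ?V = "conj_frame u v"
  obtain r where r: "det ?V = of_real r"
    using cnj_det_conj_frame by (metis complex_cnj_cancel_iff Reals_cnj_iff Reals_cases)
  have "r \<noteq> 0" using invertible_of_congruence[OF VA] r by (simp add: invertible_det_nz)
  have "det (transpose ?V ** cmat (l *\<^sub>R A - B) ** ?V) = det (cdiag (\<chi> j. of_real l - conj_pairs x y $ j))"
    by (simp only: cmat_pencil_congruence[OF VA VB])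
  also have "\<dots> = (\<Prod>j\<in>UNIV. of_real l - conj_pairs x y $ j)"
    by (simp add: det_diagonal cdiag_def)
  also have "\<dots> = ((of_real l - x) * cnj (of_real l - x)) * ((of_real l - y) * cnj (of_real l - y))"
    by (simp add: prod_4 mult.assoc)
  also have "\<dots> = of_real ((cmod (of_real l - x))\<^sup>2 * (cmod (of_real l - y))\<^sup>2)"
    by (simp only: complex_norm_square of_real_mult)
  finally have "complex_of_real (r\<^sup>2 * det (l *\<^sub>R A - B)) = of_real ((cmod (of_real l - x))\<^sup>2 * (cmod (of_real l - y))\<^sup>2)"
    by (simp add: det_mul det_transpose det_cmat r power2_eq_square mult_ac)
  then have e: "r\<^sup>2 * det (l *\<^sub>R A - B) = (cmod (of_real l - x))\<^sup>2 * (cmod (of_real l - y))\<^sup>2"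
    by (simp only: of_real_eq_iff)
  have "of_real l \<noteq> x" "of_real l \<noteq> y" using im by auto
  then have "r\<^sup>2 * det (l *\<^sub>R A - B) > 0" unfolding e by simp
  then show ?thesis using \<open>r \<noteq> 0\<close> by (simp add: zero_less_mult_iff)
qed

text \<open>The first congruence says that \<open>transpose V ** cmat A\<close> is the inverse of
  \<open>V\<close>. Therefore conjugating the matrix \<open>matrix_inv A ** B\<close> by
  \<open>V\<close> gives the same result as the congruence of \<open>B\<close>.\<close>

lemma segre_1111_of_eigenbasis:
  fixes A B :: "real^4^4"
  assumes A: "invertible A"
    and VA: "transpose V ** cmat A ** V = mat 1" and VB: "transpose V ** cmat B ** V = cdiag \<mu>"
    and inj: "inj (\<lambda>i. \<mu>$i)"
  shows "segre_1111 A B"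
proof -
  have V: "invertible V" by (rule invertible_of_congruence[OF VA])
  have "matrix_inv V = (transpose V ** cmat A ** V) ** matrix_inv V" by (simp add: VA)
  also have "\<dots> = transpose V ** cmat A ** (V ** matrix_inv V)" by (simp only: matrix_mul_assoc)
  also have "\<dots> = transpose V ** cmat A" by (simp add: matrix_inv_right V)
  finally have Vi: "matrix_inv V = transpose V ** cmat A" .
  have "matrix_inv V ** cmat (matrix_inv A ** B) ** V = transpose V ** (cmat A ** cmat (matrix_inv A)) ** cmat B ** V"
    by (simp add: Vi cmat_mult matrix_mul_assoc)
  also have "\<dots> = cdiag \<mu>" by (simp add: matrix_inv_right A cmat_1 VB flip: cmat_mult)
  finally show ?thesis using A V inj unfolding segre_1111_def by blast
qed

subsection \<open>Real coordinates\<close>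

definition cvec :: "real^4 \<Rightarrow> complex^4" where
  "cvec x = (\<chi> i. of_real (x$i))"

lemma cmat_mult_cvec: "cmat M *v cvec x = cvec (M *v x)"
  by (simp add: cmat_def cvec_def matrix_vector_mult_def vec_eq_iff)

lemma cbil_cvec: "cbil (cmat M) (cvec x) (cvec x) = of_real (x \<bullet> (M *v x))"
  by (simp only: cbil_def cmat_mult_cvec) (simp add: cvec_def inner_vec_def)

lemma sum_mult_transpose:
  fixes V :: "complex^4^4"
  shows "(\<Sum>k\<in>UNIV. (V *v c)$k * w$k) = (\<Sum>j\<in>UNIV. c$j * (transpose V *v w)$j)"
proof -
  have "(\<Sum>k\<in>UNIV. (V *v c)$k * w$k) = (\<Sum>k\<in>UNIV. \<Sum>j\<in>UNIV. c$j * (V$k$j * w$k))"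
    by (simp add: matrix_vector_mult_def sum_distrib_left sum_distrib_right mult_ac)
  also have "\<dots> = (\<Sum>j\<in>UNIV. \<Sum>k\<in>UNIV. c$j * (V$k$j * w$k))" by (rule sum.swap)
  finally show ?thesis by (simp add: matrix_vector_mult_def transpose_def sum_distrib_left)
qed

lemma quadratic_form_in_eigenbasis:
  assumes "transpose V ** cmat M ** V = cdiag \<nu>" "cvec x = V *v c"
  shows "of_real (x \<bullet> (M *v x)) = (\<Sum>j\<in>UNIV. \<nu>$j * (c$j)\<^sup>2)"
proof -
  have "of_real (x \<bullet> (M *v x)) = (\<Sum>j\<in>UNIV. c$j * (transpose V *v (cmat M *v (V *v c)))$j)"
    by (simp only: cbil_cvec[symmetric] assms(2)) (simp only: cbil_def sum_mult_transpose)
  also have "transpose V *v (cmat M *v (V *v c)) = cdiag \<nu> *v c"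
    by (simp only: matrix_vector_mul_assoc matrix_mul_assoc assms(1)[symmetric])
  also have "cdiag \<nu> *v c = (\<chi> j. \<nu>$j * c$j)"
    by (simp add: cdiag_def matrix_vector_mult_def vec_eq_iff if_distrib[of "\<lambda>t. t * _"] cong: if_cong)
  finally show ?thesis by (simp add: power2_eq_square mult_ac)
qed

text \<open>Retains only what the geometry uses. The factor \<open>2 * Re\<close> comes from adding
  each diagonal term to its conjugate; the common sign in \<open>im\<close> later governs the shape
  of the curve.\<close>

locale pencil_coordinates =
  fixes A B :: "real^4^4" and x y :: complex and a b :: "real^4 \<Rightarrow> complex"
  assumes lin: "linear a" "linear b" and bij: "bij (\<lambda>p. (a p, b p))"
    and form_A: "\<And>p. p \<bullet> (A *v p) = 2 * Re ((a p)\<^sup>2 + (b p)\<^sup>2)"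
    and form_B: "\<And>p. p \<bullet> (B *v p) = 2 * Re (x * (a p)\<^sup>2 + y * (b p)\<^sup>2)"
    and im: "Im x > 0" "Im y > 0"
text \<open>Since \<open>transpose V ** cmat A\<close> inverts the frame \<open>V\<close>, the
  coordinates of \<open>p\<close> are its \<open>A\<close>-products with the columns. For real
  \<open>p\<close> the conjugate columns give conjugate coordinates, so those along \<open>u\<close>
  and \<open>v\<close> suffice.\<close>

lemma pencil_real_coordinates:
  fixes A B :: "real^4^4"
  assumes VA: "transpose (conj_frame u v) ** cmat A ** conj_frame u v = mat 1"
    and VB: "transpose (conj_frame u v) ** cmat B ** conj_frame u v = cdiag (conj_pairs x y)"
    and im: "Im x > 0" "Im y > 0"
  obtains a b where "pencil_coordinates A B x y a b"
proof -
  let ?V = "conj_frame u v"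
  define a where "a = (\<lambda>p. cbil (cmat A) u (cvec p))"
  define b where "b = (\<lambda>p. cbil (cmat A) v (cvec p))"
  have lin: "linear (\<lambda>p. cbil (cmat A) w (cvec p))" for w
  proof (rule linearI)
    show "cbil (cmat A) w (cvec (p + q)) = cbil (cmat A) w (cvec p) + cbil (cmat A) w (cvec q)" for p q
    proof -
      have "cvec (p + q) = cvec p + cvec q" by (simp add: cvec_def vec_eq_iff)
      then show ?thesis
        by (simp add: cbil_def matrix_vector_right_distrib sum.distrib distrib_left)
    qed
    show "cbil (cmat A) w (cvec (r *\<^sub>R p)) = r *\<^sub>R cbil (cmat A) w (cvec p)" for r p
    proof -
      have "cvec (r *\<^sub>R p) = of_real r *s cvec p" by (simp add: cvec_def vec_eq_iff)
      then show ?thesis using cbil_scale[of _ 1 w "of_real r" "cvec p"] by (simp add: scaleR_conv_of_real)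
    qed
  qed
  have cnjb: "cbil (cmat A) (vcnj w) (cvec p) = cnj (cbil (cmat A) w (cvec p))" for w p
  proof -
    have "vcnj (cvec p) = cvec p" by (simp add: vcnj_def cvec_def vec_eq_iff)
    then show ?thesis by (metis cbil_vcnj)
  qed
  have W: "?V ** (transpose ?V ** cmat A) = mat 1"
    using VA matrix_left_right_inverse by blast
  have c: "transpose ?V *v (cmat A *v cvec p) = conj_pairs (a p) (b p)" for p
  proof -
    have "(transpose ?V *v (cmat A *v cvec p))$j = cbil (cmat A) (column j ?V) (cvec p)" for j
      by (simp only: transpose_mult_vec_nth cbil_def)
    moreover have "\<forall>j. cbil (cmat A) (column j ?V) (cvec p) = conj_pairs (a p) (b p) $ j"
      by (simp add: forall_4 a_def b_def cnjb)
    ultimately show ?thesis by (simp add: vec_eq_iff)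
  qed
  have Vc: "cvec p = ?V *v conj_pairs (a p) (b p)" for p
  proof -
    have "?V *v conj_pairs (a p) (b p) = (?V ** (transpose ?V ** cmat A)) *v cvec p"
      by (simp only: c[symmetric] matrix_vector_mul_assoc matrix_mul_assoc)
    then show ?thesis by (simp add: W)
  qed
  have lina: "linear a" and linb: "linear b"
    unfolding a_def b_def by (rule lin)+
  then have linab: "linear (\<lambda>p. (a p, b p))"
    by (auto simp: linear_iff)
  have "inj (\<lambda>p. (a p, b p))"
  proof (subst linear_injective_0[OF linab], intro allI impI)
    fix p assume "(a p, b p) = 0"
    then have "a p = 0" "b p = 0" by (auto simp: zero_prod_def)
    moreover have "conj_pairs 0 0 = 0" by (simp add: vec_eq_iff conj_pairs_def)
    ultimately have "cvec p = 0" using Vc[of p] by simp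
    then show "p = 0" by (simp add: cvec_def vec_eq_iff)
  qed
  moreover then have "surj (\<lambda>p. (a p, b p))"
  proof -
    \<comment> \<open>Source and target both have real dimension 4, so injectivity gives
      surjectivity.\<close>
    have "dim (range (\<lambda>p. (a p, b p))) = DIM(complex \<times> complex)"
      using dim_image_eq[OF linab, of UNIV] \<open>inj (\<lambda>p. (a p, b p))\<close> by simp
    then have "span (range (\<lambda>p. (a p, b p))) = UNIV" using dim_eq_full by blast
    then show ?thesis
      using linear_subspace_image[OF linab subspace_UNIV] by (metis span_eq_iff)
  qed
  ultimately have "bij (\<lambda>p. (a p, b p))" by (simp add: bij_def)
  moreover have "p \<bullet> (A *v p) = 2 * Re ((a p)\<^sup>2 + (b p)\<^sup>2)" for p
  proof -
    have "transpose ?V ** cmat A ** ?V = cdiag 1"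
      unfolding VA by (simp add: vec_eq_iff mat_def cdiag_def)
    from quadratic_form_in_eigenbasis[OF this Vc[of p]]
    have "of_real (p \<bullet> (A *v p)) = (a p)\<^sup>2 + cnj ((a p)\<^sup>2) + ((b p)\<^sup>2 + cnj ((b p)\<^sup>2))"
      by (simp add: sum_4)
    then show ?thesis by (simp only: complex_add_cnj) (simp add: complex_eq_iff)
  qed
  moreover have "p \<bullet> (B *v p) = 2 * Re (x * (a p)\<^sup>2 + y * (b p)\<^sup>2)" for p
  proof -
    from quadratic_form_in_eigenbasis[OF VB Vc[of p]]
    have "of_real (p \<bullet> (B *v p)) = x * (a p)\<^sup>2 + cnj (x * (a p)\<^sup>2) + (y * (b p)\<^sup>2 + cnj (y * (b p)\<^sup>2))"
      by (simp add: sum_4)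
    then show ?thesis by (simp only: complex_add_cnj) (simp add: complex_eq_iff)
  qed
  ultimately have "pencil_coordinates A B x y a b"
    using lina linb im by (intro pencil_coordinates.intro)
  then show thesis by (rule that)
qed

subsection \<open>The index function\<close>

text \<open>Makes the degree, coefficient and eigenvector lemmas for pencils available for
  eigenvalues.\<close>

lemma char_poly4_eq_pencil_poly: "char_poly4 M = pencil_poly (mat 1) M"
  unfolding char_poly4_def pencil_poly_def
  by (rule arg_cong[of _ _ det]) (simp add: vec_eq_iff mat_def)

lemma poly_char_poly4: "poly (char_poly4 M) r = det (r *\<^sub>R mat 1 - M)"
  by (simp add: char_poly4_eq_pencil_poly poly_pencil_poly)

lemma degree_char_poly4: "degree (char_poly4 M) = 4"
  using coeff_pencil_poly_4[of "mat 1" M] degree_pencil_poly_le[of "mat 1" M]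
  by (intro antisym le_degree) (auto simp: char_poly4_eq_pencil_poly)

lemma lead_coeff_char_poly4: "lead_coeff (char_poly4 M) = 1"
  unfolding degree_char_poly4 by (simp add: char_poly4_eq_pencil_poly coeff_pencil_poly_4)

lemma char_poly4_nz: "char_poly4 M \<noteq> 0"
  using lead_coeff_char_poly4[of M] by auto

text \<open>The Hermitian product of an eigenvector \<open>v\<close> with \<open>M *v v\<close> is
  its own conjugate and equals \<open>z\<close> times the positive number \<open>n\<close>.\<close>

lemma symmetric_eigenvalue_real:
  assumes sym: "transpose M = M" and z: "poly (map_poly complex_of_real (char_poly4 M)) z = 0"
  shows "z \<in> \<real>"
proof -
  obtain v where v: "v \<noteq> 0" "cmat M *v v = z *s v"
    using pencil_root_eigenvector[of "mat 1" M z] z by (auto simp: char_poly4_eq_pencil_poly cmat_1)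
  define n where "n = (\<Sum>k\<in>UNIV. (cmod (v$k))\<^sup>2)"
  have e: "cbil (cmat M) (vcnj v) v = z * of_real n"
    by (simp add: cbil_def v vcnj_def n_def sum_distrib_left complex_norm_square mult_ac del: of_real_power)
  have vv: "vcnj (vcnj v) = v" by (simp add: vcnj_def vec_eq_iff)
  have "cnj (cbil (cmat M) (vcnj v) v) = cbil (cmat M) v (vcnj v)"
    by (simp add: vv flip: cbil_vcnj)
  also have "\<dots> = cbil (cmat M) (vcnj v) v" by (rule cbil_commute) (simp add: sym transpose_cmat)
  finally have "cnj z * of_real n = z * of_real n" by (simp add: e)
  moreover obtain k where "v$k \<noteq> 0" using v(1) by (auto simp: vec_eq_iff)
  then have "n > 0" unfolding n_def by (intro sum_pos2[of _ k]) auto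
  ultimately show ?thesis by (simp add: Reals_cnj_iff)
qed

text \<open>Induction on the degree: the fundamental theorem of algebra gives a complex root, the
  hypothesis makes it real, and its linear factor is divided out.\<close>

lemma real_rooted_splits:
  fixes p :: "real poly"
  assumes "p \<noteq> 0" "\<And>z. poly (map_poly complex_of_real p) z = 0 \<Longrightarrow> z \<in> \<real>"
  shows "p = smult (lead_coeff p) (\<Prod>r\<in>#proots p. [:-r, 1:])"
  using assms
proof (induction "degree p" arbitrary: p)
  case 0
  then obtain c where "p = [:c:]" using degree_eq_zeroE by metis
  then show ?case by simp
next
  case (Suc n)
  let ?f = "map_poly complex_of_real"
  have "degree (?f p) = Suc n" using Suc by (simp add: map_poly_degree_eq)
  then have "\<not> constant (poly (?f p))" by (simp add: constant_degree)
  then obtain z where z: "poly (?f p) z = 0" using fundamental_theorem_of_algebra by blast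
  then have "z \<in> \<real>" by (rule Suc.prems(2))
  then obtain r where "z = of_real r" by (auto elim: Reals_cases)
  moreover have "poly (?f p) (of_real r) = of_real (poly p r)"
    by (induction p) (auto simp: map_poly_pCons)
  ultimately have "poly p r = 0" using z by simp
  then obtain q where q: "p = [:-r, 1:] * q" by (auto simp: poly_eq_0_iff_dvd)
  have "q \<noteq> 0" using q Suc.prems by auto
  have "degree p = Suc (degree q)"
    using q \<open>q \<noteq> 0\<close> by (simp add: degree_mult_eq del: mult_pCons_left)
  moreover have "z \<in> \<real>" if "poly (?f q) z = 0" for z
    by (rule Suc.prems(2)) (simp add: q poly_map_of_real_mult that del: mult_pCons_left)
  ultimately have "q = smult (lead_coeff q) (\<Prod>r\<in>#proots q. [:-r, 1:])"
    using Suc.hyps \<open>q \<noteq> 0\<close> by auto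
  moreover have "proots p = {#r#} + proots q"
    unfolding q by (subst proots_mult) (use \<open>q \<noteq> 0\<close> in auto)
  moreover have "lead_coeff p = lead_coeff q"
    unfolding q by (simp add: lead_coeff_mult del: mult_pCons_left)
  ultimately show ?case
    by (metis (no_types, lifting) image_mset_add_mset add_mset_add_single union_commute
        prod_mset.insert mult_smult_right q)
qed

lemma num_pos_eig_eq_size: "num_pos_eig M = size (filter_mset (\<lambda>r. r > 0) (proots (char_poly4 M)))"
  by (simp add: num_pos_eig_def size_multiset_overloaded_eq char_poly4_nz conj_commute)

section \<open>Extremal eigenvalues and the count of positive ones\<close>

lemma quadratic_nonneg_imp_linear_zero:
  fixes b c :: real
  assumes "\<And>t. 0 \<le> 2 * t * b + t\<^sup>2 * c"
  shows "b = 0"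
proof (rule ccontr)
  assume b: "b \<noteq> 0"
  \<comment> \<open>With a positive \<open>s\<close> at least as large as \<open>c\<close>, the
    choice \<open>t = - b / s\<close> bounds the expression above by
    \<open>- (b\<^sup>2 / s)\<close>.\<close>
  define s where "s = \<bar>c\<bar> + 1"
  have s: "s > 0" "c \<le> s" by (auto simp: s_def)
  have "0 \<le> 2 * (- b / s) * b + (- b / s)\<^sup>2 * c" by (rule assms)
  also have "\<dots> \<le> 2 * (- b / s) * b + (- b / s)\<^sup>2 * s"
    by (intro add_left_mono mult_left_mono) (use s in auto)
  also have "\<dots> = - (b\<^sup>2 / s)" using s by (simp add: field_simps power2_eq_square)
  also have "\<dots> < 0" using b s by simp
  finally show False by simp
qed

text \<open>A minimizer of the quadratic form on the unit sphere is an eigenvector whose eigenvalue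
  is the minimum, and the direction of \<open>x\<close> shows that this minimum is not
  positive.\<close>

lemma symmetric_nonpos_eigenvalue:
  fixes M :: "real^'n^'n"
  assumes sym: "transpose M = M" and x: "x \<noteq> 0" "x \<bullet> (M *v x) \<le> 0"
  obtains r v where "v \<noteq> 0" "M *v v = r *\<^sub>R v" "r \<le> 0"
proof -
  let ?q = "\<lambda>x. x \<bullet> (M *v x)"
  have cont: "continuous_on (sphere 0 1) ?q"
    by (intro continuous_intros)
  have "(1 / norm x) *\<^sub>R x \<in> sphere 0 1" using x by simp
  then obtain v where v: "v \<in> sphere 0 1" and min: "\<And>y. y \<in> sphere 0 1 \<Longrightarrow> ?q v \<le> ?q y"
    using continuous_attains_inf[OF compact_sphere _ cont] by blast
  define r where "r = ?q v"
  have nv: "v \<bullet> v = 1" using v by (simp add: norm_eq_1)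
  have q_scale: "?q (c *\<^sub>R y) = c\<^sup>2 * ?q y" for c y
    by (simp add: matrix_vector_mult_scaleR power2_eq_square)
  have lower: "r * (y \<bullet> y) \<le> ?q y" for y
  proof (cases "y = 0")
    case False
    then have "r \<le> ?q ((1 / norm y) *\<^sub>R y)" unfolding r_def by (intro min) simp
    also have "\<dots> = ?q y / (y \<bullet> y)" by (simp only: q_scale) (simp add: power_divide dot_square_norm)
    finally show ?thesis using False by (simp add: pos_le_divide_eq)
  qed simp
  have "r * (x \<bullet> x) \<le> 0" using lower[of x] x by linarith
  then have r: "r \<le> 0" using x(1) inner_gt_zero_iff[of x] by (metis mult_pos_pos not_le)
  have symi: "y \<bullet> (M *v w) = w \<bullet> (M *v y)" for y w
    by (metis dot_lmul_matrix inner_commute sym vector_transpose_matrix)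
  have "y \<bullet> (M *v v - r *\<^sub>R v) = 0" for y
  proof -
    let ?b = "y \<bullet> (M *v v - r *\<^sub>R v)" and ?c = "?q y - r * (y \<bullet> y)"
    \<comment> \<open>\<open>lower\<close> is an equality at \<open>v\<close>, so at
      \<open>v + t *\<^sub>R y\<close> the constant term cancels and only the terms in
      \<open>t\<close> and \<open>t\<^sup>2\<close> remain.\<close>
    have quad: "0 \<le> 2 * t * ?b + t\<^sup>2 * ?c" for t
      using lower[of "v + t *\<^sub>R y"] symi[of v y] nv
      by (simp add: r_def matrix_vector_right_distrib matrix_vector_mult_scaleR algebra_simps
          inner_simps power2_eq_square inner_commute)
    then show ?thesis by (rule quadratic_nonneg_imp_linear_zero)
  qed
  then have "M *v v - r *\<^sub>R v = 0" using inner_eq_zero_iff by blast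
  moreover have "v \<noteq> 0" using nv by auto
  ultimately show thesis using that[of v r] r by simp
qed

lemma eigenvector_imp_root:
  assumes "v \<noteq> 0" "M *v v = r *\<^sub>R v"
  shows "poly (char_poly4 M) r = 0"
proof -
  have "(r *\<^sub>R mat 1 - M) *v v = 0"
    using assms by (simp add: matrix_vector_mult_diff_rdistrib scaleR_matrix_vector_assoc[symmetric])
  then have "\<not> invertible (r *\<^sub>R mat 1 - M)"
    unfolding invertible_left_inverse matrix_left_invertible_ker using assms(1) by blast
  then show ?thesis by (simp add: poly_char_poly4 invertible_det_nz)
qed

text \<open>A positive determinant means four nonzero eigenvalues with an even number of negative
  ones. The isotropic vector, used for \<open>M\<close> and for \<open>- M\<close>, yields one
  eigenvalue of each sign, leaving two and two.\<close>

lemma num_pos_eig_eq_2: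
  assumes sym: "transpose M = M" and det: "det M > 0" and x: "x \<noteq> 0" "x \<bullet> (M *v x) = 0"
  shows "num_pos_eig M = 2"
proof -
  let ?p = "char_poly4 M"
  have split: "?p = (\<Prod>r\<in>#proots ?p. [:-r, 1:])"
    using real_rooted_splits[OF char_poly4_nz symmetric_eigenvalue_real[OF sym]]
    by (simp add: lead_coeff_char_poly4)
  have "degree (\<Prod>r\<in>#R. [:-r, 1:]) = size R" for R :: "real multiset"
  proof (induction R)
    case (add r R)
    have "(\<Prod>r\<in>#R. [:-r, 1:]) \<noteq> 0" by (auto simp: prod_mset_zero_iff)
    then show ?case using add by (simp add: degree_mult_eq del: mult_pCons_left)
  qed simp
  then have "size (proots ?p) = 4" using split degree_char_poly4 by metis
  then obtain a b c d where R: "proots ?p = {#a, b, c, d#}"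
  proof -
    obtain xs where "mset xs = proots ?p" by (metis ex_mset)
    moreover with \<open>size (proots ?p) = 4\<close> have "length xs = 4" by (metis size_mset)
    then obtain a b c d where "xs = [a, b, c, d]"
      by (auto simp: numeral_eq_Suc length_Suc_conv)
    ultimately show thesis using that[of a b c d] by simp
  qed
  have mem: "poly ?p r = 0 \<longleftrightarrow> r \<in># {#a, b, c, d#}" for r
    using set_count_proots[OF char_poly4_nz, of M] by (auto simp: R)
  have "poly ?p 0 = det (- M)" by (simp add: poly_char_poly4)
  \<comment> \<open>The dimension 4 is even, so the four signs cancel.\<close>
  also have "\<dots> = det M" by (simp add: det_def prod_uminus)
  finally have "poly ?p 0 = det M" .
  moreover have "poly ?p 0 = a * b * c * d" by (subst split) (simp add: R)
  ultimately have pos: "a * b * c * d > 0" using det by simp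
  then have nz: "a \<noteq> 0" "b \<noteq> 0" "c \<noteq> 0" "d \<noteq> 0" by auto
  obtain r v where "v \<noteq> 0" "M *v v = r *\<^sub>R v" "r \<le> 0"
    using symmetric_nonpos_eigenvalue[OF sym x(1) eq_refl[OF x(2)]] by blast
  then have "r \<in># {#a, b, c, d#}" "r \<le> 0" using eigenvector_imp_root mem by blast+
  then have neg: "a < 0 \<or> b < 0 \<or> c < 0 \<or> d < 0" using nz by auto
  have negM: "(- M) *v w = - (M *v w)" for w
    by (simp add: matrix_vector_mult_def vec_eq_iff sum_negf)
  have "transpose (- M) = - M" using sym by (simp add: transpose_def vec_eq_iff)
  moreover have "x \<bullet> ((- M) *v x) \<le> 0" using x by (simp add: negM)
  ultimately obtain s w where s: "w \<noteq> 0" "(- M) *v w = s *\<^sub>R w" "s \<le> 0"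
    using symmetric_nonpos_eigenvalue[OF _ x(1)] by blast
  then have "M *v w = (- s) *\<^sub>R w" by (metis negM scaleR_minus_left minus_equation_iff)
  then have "- s \<in># {#a, b, c, d#}" using eigenvector_imp_root[OF s(1)] mem by blast
  moreover have "- s \<ge> 0" using s(3) by simp
  ultimately have pos': "a > 0 \<or> b > 0 \<or> c > 0 \<or> d > 0" using nz by auto
  show ?thesis
    unfolding num_pos_eig_eq_size R
    using pos neg pos' nz by (auto simp: zero_less_mult_iff mult_less_0_iff)
qed

subsection \<open>The topology of projective space\<close>

lemma mem_proj_pt: "x \<in> proj_pt x"
  unfolding proj_pt_def using scaleR_one[of x] by (metis (mono_tags, lifting) CollectI zero_neq_one)

lemma proj_pt_scale: "c \<noteq> 0 \<Longrightarrow> proj_pt (c *\<^sub>R x) = proj_pt x"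
proof -
  assume c: "c \<noteq> 0"
  have "\<exists>e. d *\<^sub>R x = e *\<^sub>R (c *\<^sub>R x) \<and> e \<noteq> 0" if "d \<noteq> 0" for d
    using that c by (intro exI[of _ "d / c"]) auto
  then show ?thesis using c by (auto simp: proj_pt_def)
qed

lemma proj_pt_eqI: "y \<in> proj_pt x \<Longrightarrow> proj_pt y = proj_pt x"
  by (auto simp: proj_pt_def[of x] proj_pt_scale)

lemma PR3_memD:
  assumes "p \<in> PR3" "x \<in> p"
  shows "x \<noteq> 0" "p = proj_pt x"
proof -
  obtain y where y: "p = proj_pt y" "y \<noteq> 0" using assms(1) by (auto simp: PR3_def)
  then show "p = proj_pt x" using assms(2) proj_pt_eqI by blast
  show "x \<noteq> 0" using assms(2) y by (auto simp: proj_pt_def)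
qed

text \<open>Projective points are pairwise disjoint punctured lines. This is the intersection axiom
  for the quotient topology.\<close>

lemma Union_Int_PR3:
  assumes "U \<subseteq> PR3" "V \<subseteq> PR3"
  shows "\<Union>(U \<inter> V) = \<Union>U \<inter> \<Union>V"
proof
  show "\<Union>U \<inter> \<Union>V \<subseteq> \<Union>(U \<inter> V)"
  proof
    fix x assume "x \<in> \<Union>U \<inter> \<Union>V"
    then obtain p q where "p \<in> U" "x \<in> p" "q \<in> V" "x \<in> q" by auto
    moreover then have "p = q" using PR3_memD(2) assms by (metis subsetD)
    ultimately show "x \<in> \<Union>(U \<inter> V)" by auto
  qed
qed auto

lemma openin_PR3: "openin PR3_topology U \<longleftrightarrow> U \<subseteq> PR3 \<and> open (\<Union>U)"
proof -
  have "istopology (\<lambda>U. U \<subseteq> PR3 \<and> open (\<Union>U))"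
    unfolding istopology_def
  proof (intro conjI allI impI)
    fix \<K> :: "(real^4) set set set"
    assume "\<forall>K\<in>\<K>. K \<subseteq> PR3 \<and> open (\<Union>K)"
    then have "open (\<Union>K\<in>\<K>. \<Union>K)" by (intro open_UN) auto
    moreover have "(\<Union>K\<in>\<K>. \<Union>K) = \<Union>(\<Union>\<K>)" by auto
    ultimately show "open (\<Union>(\<Union>\<K>))" by simp
  qed (auto simp: Union_Int_PR3)
  then show ?thesis by (simp add: PR3_topology_def topology_inverse')
qed

lemma Union_PR3: "\<Union>PR3 = - {0}"
proof
  show "- {0} \<subseteq> \<Union>PR3" using mem_proj_pt by (auto simp: PR3_def)
qed (use PR3_memD(1) in blast)

lemma topspace_PR3: "topspace PR3_topology = PR3"
proof -
  have "openin PR3_topology PR3" by (simp add: openin_PR3 Union_PR3 open_Compl)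
  then show ?thesis
    using openin_PR3 by (metis openin_subset openin_topspace subset_antisym)
qed

lemma continuous_map_proj_pt: "continuous_map (top_of_set (- {0})) PR3_topology proj_pt"
proof -
  have "openin (top_of_set (- {0})) {x \<in> - {0}. proj_pt x \<in> U}" if U: "openin PR3_topology U" for U
  proof -
    have sub: "U \<subseteq> PR3" and op: "open (\<Union>U)" using U by (simp_all add: openin_PR3)
    have "{x \<in> - {0}. proj_pt x \<in> U} = - {0} \<inter> \<Union>U"
    proof (intro set_eqI iffI)
      fix x assume "x \<in> - {0} \<inter> \<Union>U"
      then obtain p where "x \<noteq> 0" "p \<in> U" "x \<in> p" by auto
      moreover then have "p = proj_pt x" using PR3_memD(2) sub by blast
      ultimately show "x \<in> {x \<in> - {0}. proj_pt x \<in> U}" by simp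
    qed (use mem_proj_pt in auto)
    then show ?thesis using op by (simp add: openin_open_Int)
  qed
  then show ?thesis by (auto simp: continuous_map topspace_PR3 PR3_def)
qed

lemma connectedin_proj_pt_image:
  assumes "connected C" "0 \<notin> C"
  shows "connectedin PR3_topology (proj_pt ` C)"
  using assms by (intro connectedin_continuous_map_image[OF continuous_map_proj_pt])
    (auto simp: connectedin_subtopology)

lemma Union_proj_pt_cone:
  assumes "\<And>x c. x \<in> S \<Longrightarrow> c \<noteq> 0 \<Longrightarrow> c *\<^sub>R x \<in> S"
  shows "\<Union>(proj_pt ` S) = S"
  using assms mem_proj_pt by (auto simp: proj_pt_def)

text \<open>Openness of a set of projective points is tested on its union, and for a set stable
  under nonzero scaling that union is the set itself.\<close>

lemma openin_proj_pt_cone: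
  assumes "open S" "0 \<notin> S" "\<And>x c. x \<in> S \<Longrightarrow> c \<noteq> 0 \<Longrightarrow> c *\<^sub>R x \<in> S"
  shows "openin PR3_topology (proj_pt ` S)"
  using assms Union_proj_pt_cone[of S] by (auto simp: openin_PR3 PR3_def)

text \<open>Each of the two pieces is clopen because the other is open. A connected set meeting a
  clopen set lies inside it, so each connected piece is a full component.\<close>

lemma connected_components_of_two_open:
  assumes "openin X K" "openin X L" "connectedin X K" "connectedin X L"
    and "K \<inter> L = {}" "K \<noteq> {}" "L \<noteq> {}" "K \<union> L = topspace X"
  shows "connected_components_of X = {K, L}"
proof -
  have comp: "connected_component_of_set X x = K"
    if "openin X K" "openin X L" "connectedin X K" "K \<inter> L = {}" "K \<union> L = topspace X" "x \<in> K" for K L x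
  proof
    show "K \<subseteq> connected_component_of_set X x"
      using that by (intro connected_component_of_maximal)
    have "topspace X - L = K" using that by auto
    then have "closedin X K" using that(2) by (metis closedin_diff closedin_topspace)
    moreover have "connectedin X (connected_component_of_set X x)"
      by (rule connectedin_connected_component_of)
    moreover have "x \<in> connected_component_of_set X x"
      using that by (auto simp: connected_component_of_refl)
    ultimately show "connected_component_of_set X x \<subseteq> K"
      using connectedin_clopen_cases[of X "connected_component_of_set X x" K] that by (auto simp: disjnt_def)
  qed
  have "connected_component_of_set X x = K" if "x \<in> K" for x using comp[of K L x] assms that by auto
  moreover have "connected_component_of_set X x = L" if "x \<in> L" for x
    using comp[of L K x] assms that by (auto simp: Int_commute Un_commute)
  ultimately show ?thesis
    using assms(6-8) unfolding connected_components_of_def by blast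
qed

lemma proj_pt_mem_QSIC:
  assumes "x \<noteq> 0"
  shows "proj_pt x \<in> QSIC A B \<longleftrightarrow> x \<bullet> (A *v x) = 0 \<and> x \<bullet> (B *v x) = 0"
proof -
  have "proj_pt x \<in> proj_quadric M \<longleftrightarrow> x \<bullet> (M *v x) = 0" for M
    using assms mem_proj_pt
    by (auto simp: proj_quadric_def PR3_def proj_pt_def matrix_vector_mult_scaleR)
  then show ?thesis by (simp add: QSIC_def)
qed

subsection \<open>The two branches of the intersection curve\<close>

text \<open>Factoring out \<open>\<alpha> w\<^sup>2\<close> leaves a radicand in the right half plane, away from the branch cut.\<close>
definition branch :: "complex \<Rightarrow> complex \<Rightarrow> complex \<Rightarrow> complex" where
  "branch \<alpha> \<beta> w = csqrt \<alpha> * w * csqrt (1 + \<beta> / \<alpha> * (cnj w / w)\<^sup>2)"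

lemma branch_squared:
  assumes "\<alpha> \<noteq> 0" "w \<noteq> 0"
  shows "(branch \<alpha> \<beta> w)\<^sup>2 = \<alpha> * w\<^sup>2 + \<beta> * (cnj w)\<^sup>2"
  using assms by (simp add: branch_def power_mult_distrib field_simps)

text \<open>The quotient \<open>cnj w / w\<close> has modulus 1, so the term added to 1 has modulus
  \<open>cmod \<beta> / cmod \<alpha>\<close>, which is below 1.\<close>

lemma Re_branch_radicand:
  assumes "cmod \<beta> < cmod \<alpha>" "w \<noteq> 0"
  shows "0 < Re (1 + \<beta> / \<alpha> * (cnj w / w)\<^sup>2)"
proof -
  have "cmod (\<beta> / \<alpha> * (cnj w / w)\<^sup>2) = cmod \<beta> / cmod \<alpha>"
    using assms by (simp add: norm_mult norm_divide norm_power)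
  also have "\<dots> < 1" using assms by (simp add: divide_less_eq)
  finally show ?thesis
    using abs_Re_le_cmod[of "\<beta> / \<alpha> * (cnj w / w)\<^sup>2"] by simp
qed

lemma branch_nz:
  assumes "cmod \<beta> < cmod \<alpha>" "w \<noteq> 0"
  shows "branch \<alpha> \<beta> w \<noteq> 0"
proof -
  have "1 + \<beta> / \<alpha> * (cnj w / w)\<^sup>2 \<noteq> 0"
    using Re_branch_radicand[OF assms] by (metis less_irrefl zero_complex.sel(1))
  then show ?thesis using assms by (auto simp: branch_def)
qed

text \<open>\<open>cnj w / w\<close> does not change under real scaling, negative factors included.
  In particular the branch is odd.\<close>

lemma branch_scale: "c \<noteq> 0 \<Longrightarrow> branch \<alpha> \<beta> (of_real c * w) = of_real c * branch \<alpha> \<beta> w"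
  by (simp add: branch_def)

lemma continuous_on_branch:
  assumes "cmod \<beta> < cmod \<alpha>"
  shows "continuous_on (- {0}) (branch \<alpha> \<beta>)"
proof -
  have "continuous_on (- {0}) (\<lambda>w. csqrt (1 + \<beta> / \<alpha> * (cnj w / w)\<^sup>2))"
  proof (rule continuous_on_compose2[OF continuous_on_csqrt])
    show "continuous_on (- {0}) (\<lambda>w. 1 + \<beta> / \<alpha> * (cnj w / w)\<^sup>2)"
      by (intro continuous_intros) auto
    show "(\<lambda>w. 1 + \<beta> / \<alpha> * (cnj w / w)\<^sup>2) ` (- {0}) \<subseteq> - \<real>\<^sub>\<le>\<^sub>0"
      using Re_branch_radicand[OF assms] by (fastforce simp: complex_nonpos_Reals_iff)
  qed
  then show ?thesis unfolding branch_def[abs_def] by (intro continuous_intros)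
qed

lemma real_linear_system:
  fixes x y :: complex
  assumes "Im x > 0" "Im y > 0"
  shows "\<exists>\<alpha> \<beta>. cmod \<beta> < cmod \<alpha> \<and>
    (\<forall>u w. Re (u + w) = 0 \<and> Re (x * u + y * w) = 0 \<longleftrightarrow> u = \<alpha> * w + \<beta> * cnj w)"
proof -
  \<comment> \<open>The equations force \<open>Re u = - Re w\<close>, and the second then determines
    \<open>Im u\<close> linearly. \<open>\<alpha>\<close> and \<open>\<beta>\<close> write this real
    linear map in terms of \<open>w\<close> and \<open>cnj w\<close>. Both have imaginary part
    \<open>k\<close>, so their moduli compare through \<open>Im x + Im y\<close> and
    \<open>Im y - Im x\<close>.\<close>
  define k where "k = (Re y - Re x) / (2 * Im x)"
  define \<alpha> where "\<alpha> = Complex (- (Im x + Im y) / (2 * Im x)) k"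
  define \<beta> where "\<beta> = Complex ((Im y - Im x) / (2 * Im x)) k"
  show ?thesis
  proof (intro exI conjI allI)
    have "\<bar>Im y - Im x\<bar> < \<bar>Im x + Im y\<bar>" using assms by linarith
    then have "(Im y - Im x)\<^sup>2 < (Im x + Im y)\<^sup>2" by (metis abs_ge_zero power2_abs power_strict_mono zero_less_numeral)
    then show "cmod \<beta> < cmod \<alpha>"
      using assms by (simp add: \<alpha>_def \<beta>_def cmod_def power_divide divide_strict_right_mono
          power2_minus[of "Im x + Im y", simplified])
    show "Re (u + w) = 0 \<and> Re (x * u + y * w) = 0 \<longleftrightarrow> u = \<alpha> * w + \<beta> * cnj w" for u w
    proof -
      have "Re (\<alpha> * w + \<beta> * cnj w) = - Re w"
        using assms by (simp add: \<alpha>_def \<beta>_def field_simps)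
      moreover have "Im (\<alpha> * w + \<beta> * cnj w) = ((Re y - Re x) * Re w - Im y * Im w) / Im x"
        using assms by (simp add: \<alpha>_def \<beta>_def k_def field_simps)
      moreover have "Re (u + w) = 0 \<longleftrightarrow> Re u = - Re w" by auto
      moreover have "Re (x * u + y * w) = 0 \<longleftrightarrow> Im u = ((Re y - Re x) * Re w - Im y * Im w) / Im x"
        if "Re u = - Re w"
        using assms that by (auto simp: eq_divide_eq algebra_simps)
      ultimately show ?thesis unfolding complex_eq_iff[of u] by metis
    qed
  qed
qed

lemma connected_punctured_complex: "connected (- {0 :: complex})"
  by (rule connected_punctured_universe) simp

text \<open>The punctured plane is connected and contains both 1 and -1, where \<open>F\<close>
  takes opposite values.\<close>

lemma odd_function_has_zero:
  fixes F :: "complex \<Rightarrow> real"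
  assumes cont: "continuous_on (- {0}) F" and odd: "F (- 1) = - F 1"
  obtains w where "w \<noteq> 0" "F w = 0"
proof -
  have "connected (F ` (- {0}))"
    by (rule connected_continuous_image[OF cont connected_punctured_complex])
  moreover have "F 1 \<in> F ` (- {0})" "F (- 1) \<in> F ` (- {0})" by auto
  ultimately have "0 \<in> F ` (- {0})"
    using odd unfolding connected_iff_interval by (metis linear neg_le_0_iff_le neg_0_le_iff_le)
  then obtain w where "0 = F w" "w \<in> - {0}" by (rule imageE)
  then show thesis using that[of w] by simp
qed

section \<open>The intersection curve in the coordinates of the pencil\<close>

context pencil_coordinates
begin

definition pt :: "complex \<Rightarrow> complex \<Rightarrow> real^4" where
  "pt u w = inv (\<lambda>p. (a p, b p)) (u, w)"

lemma coord_pt [simp]: "a (pt u w) = u" "b (pt u w) = w"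
  using surj_f_inv_f[OF bij_is_surj[OF bij], of "(u, w)"] by (auto simp: pt_def)

lemma pt_coord [simp]: "pt (a p) (b p) = p"
  unfolding pt_def by (rule inv_f_f[OF bij_is_inj[OF bij]])

lemma linear_pt: "linear (\<lambda>(u, w). pt u w)"
proof -
  have eq: "p = q" if "a p = a q" "b p = b q" for p q
    using that pt_coord by metis
  show ?thesis
    by (rule linearI) (auto intro!: eq simp: linear_add[OF lin(1)] linear_add[OF lin(2)]
        linear_scale[OF lin(1)] linear_scale[OF lin(2)])
qed

lemma pt_eq_0_iff: "pt u w = 0 \<longleftrightarrow> u = 0 \<and> w = 0"
  by (metis coord_pt pt_coord linear_0[OF lin(1)] linear_0[OF lin(2)])

lemma pt_scale: "pt (of_real c * u) (of_real c * w) = c *\<^sub>R pt u w"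
  using linear_scale[OF linear_pt, of c "(u, w)"] by (simp add: scaleR_conv_of_real)

lemma continuous_on_pt:
  assumes "continuous_on S f"
  shows "continuous_on S (\<lambda>w. pt (f w) w)"
proof -
  have "continuous_on UNIV (\<lambda>(u, w). pt u w)"
    using linear_pt by (intro linear_continuous_on) (simp add: linear_conv_bounded_linear)
  then have "continuous_on S (\<lambda>w. (\<lambda>(u, w). pt u w) (f w, w))"
    by (rule continuous_on_compose2[where f = "\<lambda>w. (f w, w)"])
      (auto intro!: continuous_intros assms)
  then show ?thesis by simp
qed

lemma isotropic_vector: "\<exists>p. p \<noteq> 0 \<and> p \<bullet> ((l *\<^sub>R A - B) *v p) = 0"
proof -
  have nz: "of_real l - x \<noteq> 0" using im by (auto simp: complex_eq_iff)
  \<comment> \<open>The vector is sought with second coordinate 0. This square root makes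
    \<open>(of_real l - x) * u\<^sup>2\<close> equal to the imaginary unit, whose real part
    vanishes.\<close>
  define u where "u = csqrt (\<i> / (of_real l - x))"
  have "(of_real l - x) * u\<^sup>2 = \<i>" using nz by (simp add: u_def)
  then have "Re (of_real l * u\<^sup>2) - Re (x * u\<^sup>2) = 0"
    by (simp only: left_diff_distrib minus_complex.sel(1)[symmetric]) simp
  then have "l * Re (u\<^sup>2) = Re (x * u\<^sup>2)" by simp
  moreover have "pt u 0 \<bullet> ((l *\<^sub>R A - B) *v pt u 0) = 2 * (l * Re (u\<^sup>2) - Re (x * u\<^sup>2))"
    by (simp only: matrix_vector_mult_diff_rdistrib scaleR_matrix_vector_assoc[symmetric]
        inner_diff_right inner_scaleR_right form_A form_B coord_pt) simp
  moreover have "pt u 0 \<noteq> 0" using nz by (simp add: pt_eq_0_iff u_def)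
  ultimately show ?thesis by auto
qed

lemma QSIC_two_open_components:
  "card (QSIC_components A B) = 2 \<and> (\<forall>K \<in> QSIC_components A B. open_component K)"
proof -
  obtain \<alpha> \<beta> where less: "cmod \<beta> < cmod \<alpha>"
    and solve: "\<And>u w. Re (u + w) = 0 \<and> Re (x * u + y * w) = 0 \<longleftrightarrow> u = \<alpha> * w + \<beta> * cnj w"
    using real_linear_system[OF im] by metis
  define s where "s = branch \<alpha> \<beta>"
  have \<alpha>: "\<alpha> \<noteq> 0" using less by auto
  have s_sq: "(s w)\<^sup>2 = \<alpha> * w\<^sup>2 + \<beta> * cnj (w\<^sup>2)" if "w \<noteq> 0" for w
    using branch_squared[OF \<alpha> that] by (simp add: s_def)
  have s_nz: "s w \<noteq> 0" if "w \<noteq> 0" for w using branch_nz[OF less that] by (simp add: s_def)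
  have s_scale: "s (of_real c * w) = of_real c * s w" if "c \<noteq> 0" for c w
    using branch_scale[OF that] by (simp add: s_def)
  have s_cont: "continuous_on (- {0}) s" unfolding s_def by (rule continuous_on_branch[OF less])
  have QSIC_iff: "proj_pt p \<in> QSIC A B \<longleftrightarrow> (a p)\<^sup>2 = \<alpha> * (b p)\<^sup>2 + \<beta> * cnj ((b p)\<^sup>2)" if "p \<noteq> 0" for p
  proof -
    have "proj_pt p \<in> QSIC A B \<longleftrightarrow>
        Re ((a p)\<^sup>2 + (b p)\<^sup>2) = 0 \<and> Re (x * (a p)\<^sup>2 + y * (b p)\<^sup>2) = 0"
      by (simp only: proj_pt_mem_QSIC[OF that] form_A form_B mult_eq_0_iff) simp
    then show ?thesis by (simp only: solve)
  qed
  \<comment> \<open>For \<open>\<sigma>\<close> equal to 1 or -1, \<open>c \<sigma>\<close>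
    parametrizes the branch on which \<open>a\<close> is \<open>\<sigma>\<close> times
    \<open>s b\<close> by the punctured \<open>b\<close>-plane. The open cones
    \<open>U \<sigma>\<close> separate the branches: on them \<open>a * cnj (s b)\<close> is plus or
    minus the squared modulus of \<open>s b\<close>.\<close>
  define c where "c = (\<lambda>\<sigma> w. pt (of_real \<sigma> * s w) w)"
  define K where "K = (\<lambda>\<sigma>. proj_pt ` (c \<sigma> ` (- {0})))"
  define U where "U = (\<lambda>\<sigma>::real. {p. b p \<noteq> 0 \<and> 0 < \<sigma> * Re (a p * cnj (s (b p)))})"
  have c_cont: "continuous_on (- {0}) (c \<sigma>)" for \<sigma>
    unfolding c_def by (intro continuous_on_pt continuous_intros s_cont)
  have c_nz: "c \<sigma> w \<noteq> 0" if "w \<noteq> 0" for \<sigma> w using that by (simp add: c_def pt_eq_0_iff)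
  \<comment> \<open>Both \<open>a\<close> and \<open>s b\<close> acquire the factor
    \<open>r\<close>, so the defining real part is multiplied by \<open>r\<^sup>2\<close> and keeps
    its sign even for negative \<open>r\<close>.\<close>
  have cone: "r *\<^sub>R p \<in> U \<sigma>" if "p \<in> U \<sigma>" "r \<noteq> 0" for p r \<sigma>
  proof -
    have "a (r *\<^sub>R p) = of_real r * a p" "b (r *\<^sub>R p) = of_real r * b p"
      using linear_scale[OF lin(1)] linear_scale[OF lin(2)] by (simp_all add: scaleR_conv_of_real)
    moreover have "of_real r * a p * cnj (of_real r * s (b p)) = of_real (r\<^sup>2) * (a p * cnj (s (b p)))"
      by (simp add: power2_eq_square)
    moreover have "Re (of_real (r\<^sup>2) * (a p * cnj (s (b p)))) = r\<^sup>2 * Re (a p * cnj (s (b p)))"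
      by (simp only: Re_complex_of_real times_complex.sel(1) Im_complex_of_real)
    ultimately have "\<sigma> * Re (a (r *\<^sub>R p) * cnj (s (b (r *\<^sub>R p)))) = r\<^sup>2 * (\<sigma> * Re (a p * cnj (s (b p))))"
      by (simp only: s_scale[OF that(2)] mult.left_commute)
    moreover have "0 < r\<^sup>2 * (\<sigma> * Re (a p * cnj (s (b p))))" "b p \<noteq> 0"
      using that by (auto simp: U_def simp del: times_complex.sel)
    moreover have "b (r *\<^sub>R p) \<noteq> 0"
      using \<open>b p \<noteq> 0\<close> \<open>b (r *\<^sub>R p) = of_real r * b p\<close> that(2) by simp
    ultimately show ?thesis unfolding U_def by (simp only: mem_Collect_eq simp_thms)
  qed
  have U_open: "open (U \<sigma>)" for \<sigma>
  proof -
    have ca: "continuous_on S a" and cb: "continuous_on S b" for S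
      using lin by (auto intro: linear_continuous_on simp: linear_conv_bounded_linear)
    have op: "open {p. b p \<noteq> 0}"
      using open_vimage[OF open_Compl[OF closed_singleton[of 0]] cb[of UNIV]]
      by (simp add: vimage_def)
    have "continuous_on {p. b p \<noteq> 0} (\<lambda>p. s (b p))"
      by (rule continuous_on_compose2[OF s_cont cb]) auto
    then have "continuous_on {p. b p \<noteq> 0} (\<lambda>p. \<sigma> * Re (a p * cnj (s (b p))))"
      by (intro continuous_intros ca)
    from continuous_open_preimage[OF this op open_greaterThan[of 0]]
    show ?thesis by (simp add: U_def vimage_def Int_def)
  qed
  have U_nz: "0 \<notin> U \<sigma>" for \<sigma> by (simp add: U_def linear_0[OF lin(2)])
  have K_eq: "K \<sigma> = QSIC A B \<inter> proj_pt ` U \<sigma>" if \<sigma>: "\<sigma> = 1 \<or> \<sigma> = -1" for \<sigma>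
  proof (intro equalityI subsetI)
    fix q assume "q \<in> K \<sigma>"
    then obtain w where w: "w \<noteq> 0" "q = proj_pt (c \<sigma> w)" by (auto simp: K_def)
    have "q \<in> QSIC A B"
      unfolding w(2) QSIC_iff[OF c_nz[OF w(1)]] using \<sigma> s_sq[OF w(1)] by (auto simp: c_def power_mult_distrib)
    moreover have "\<sigma> * Re (of_real \<sigma> * s w * cnj (s w)) = (cmod (s w))\<^sup>2"
      using \<sigma> by (auto simp: cmod_power2 simp flip: power2_eq_square)
    then have "c \<sigma> w \<in> U \<sigma>" using w s_nz[OF w(1)] by (simp add: U_def c_def)
    ultimately show "q \<in> QSIC A B \<inter> proj_pt ` U \<sigma>" using w by blast
  next
    fix q assume "q \<in> QSIC A B \<inter> proj_pt ` U \<sigma>"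
    then obtain p where p: "p \<in> U \<sigma>" "q = proj_pt p" "proj_pt p \<in> QSIC A B" by auto
    have bp: "b p \<noteq> 0" using p by (simp add: U_def)
    have "p \<noteq> 0" using p U_nz by auto
    then have "(a p)\<^sup>2 = (s (b p))\<^sup>2" using p(3) QSIC_iff s_sq[OF bp] by simp
    then have "a p = s (b p) \<or> a p = - s (b p)" by (simp add: power2_eq_iff)
    moreover have "Re (s (b p) * cnj (s (b p))) \<ge> 0" by simp
    ultimately have "a p = of_real \<sigma> * s (b p)"
      using p(1) \<sigma> by (auto simp: U_def simp del: times_complex.sel)
    then have "p = c \<sigma> (b p)" using pt_coord[of p] by (simp add: c_def)
    then show "q \<in> K \<sigma>" using bp p(2) by (auto simp: K_def)
  qed
  let ?X = "subtopology PR3_topology (QSIC A B)"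
  have K_open: "openin ?X (K \<sigma>)" if "\<sigma> = 1 \<or> \<sigma> = -1" for \<sigma>
    using openin_proj_pt_cone[OF U_open U_nz cone] K_eq[OF that]
    by (auto simp: openin_subtopology Int_commute)
  have K_conn: "connectedin ?X (K \<sigma>)" if "\<sigma> = 1 \<or> \<sigma> = -1" for \<sigma>
  proof -
    have "connected (c \<sigma> ` (- {0}))"
      by (rule connected_continuous_image[OF c_cont connected_punctured_complex])
    moreover have "0 \<notin> c \<sigma> ` (- {0})" using c_nz by fastforce
    ultimately have "connectedin PR3_topology (K \<sigma>)"
      unfolding K_def by (rule connectedin_proj_pt_image)
    then show ?thesis using K_eq[OF that] by (simp add: connectedin_subtopology)
  qed
  have K_ne: "K \<sigma> \<noteq> {}" for \<sigma> by (auto simp: K_def)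
  have disj: "K 1 \<inter> K (-1) = {}"
  proof (rule ccontr)
    assume "K 1 \<inter> K (-1) \<noteq> {}"
    then obtain p q where pq: "p \<in> U 1" "q \<in> U (-1)" "proj_pt p = proj_pt q"
      using K_eq[of 1] K_eq[of "-1"] by auto
    then have "p \<in> \<Union>(proj_pt ` U (-1))" using mem_proj_pt[of p] by auto
    then have "p \<in> U (-1)" using Union_proj_pt_cone[OF cone] by blast
    then show False using pq(1) by (simp add: U_def)
  qed
  have cover: "K 1 \<union> K (-1) = topspace ?X"
  proof -
    have "QSIC A B \<subseteq> K 1 \<union> K (-1)"
    proof
      fix q assume q: "q \<in> QSIC A B"
      then have "q \<in> PR3" by (auto simp: QSIC_def proj_quadric_def)
      then obtain p where p: "q = proj_pt p" "p \<noteq> 0" by (auto simp: PR3_def)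
      then have e: "(a p)\<^sup>2 = \<alpha> * (b p)\<^sup>2 + \<beta> * cnj ((b p)\<^sup>2)" using q QSIC_iff by blast
      \<comment> \<open>No point of the curve is lost by puncturing the \<open>b\<close>-plane: on
        the curve \<open>b = 0\<close> forces \<open>a = 0\<close>.\<close>
      have bp: "b p \<noteq> 0"
      proof
        assume "b p = 0"
        with e have "a p = 0" by simp
        with \<open>b p = 0\<close> p(2) show False using pt_coord[of p] pt_eq_0_iff by metis
      qed
      then have "(a p)\<^sup>2 = (s (b p))\<^sup>2" using e s_sq by simp
      then have "a p = s (b p) \<or> a p = - s (b p)" by (simp add: power2_eq_iff)
      then have "p = c 1 (b p) \<or> p = c (-1) (b p)" by (simp add: c_def) (metis pt_coord)
      then show "q \<in> K 1 \<union> K (-1)" using bp p(1) by (auto simp: K_def)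
    qed
    moreover have "QSIC A B \<subseteq> PR3" by (auto simp: QSIC_def proj_quadric_def)
    ultimately show ?thesis using K_eq[of 1] K_eq[of "-1"] by (auto simp: topspace_PR3)
  qed
  have comps: "QSIC_components A B = {K 1, K (-1)}"
    unfolding QSIC_components_def
    by (rule connected_components_of_two_open) (use K_open K_conn K_ne disj cover in auto)
  have "K 1 \<noteq> K (-1)" using disj K_ne by auto
  then have "card (QSIC_components A B) = 2" by (simp add: comps)
  moreover have "open_component (K \<sigma>)" for \<sigma>
    unfolding open_component_def
  proof (intro allI impI)
    fix e :: "real^4"
    \<comment> \<open>Oddness of \<open>s\<close> makes the lifted branch antipodally symmetric, so
      every linear form takes opposite values at the parameters 1 and -1.\<close>
    have "c \<sigma> (- 1) = - c \<sigma> 1"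
      using s_scale[of "-1" 1] pt_scale[of "-1" "of_real \<sigma> * s 1" 1] by (simp add: c_def)
    moreover have "continuous_on (- {0}) (\<lambda>w. e \<bullet> c \<sigma> w)"
      by (intro continuous_intros c_cont)
    ultimately obtain w where w: "w \<noteq> 0" "e \<bullet> c \<sigma> w = 0"
      using odd_function_has_zero[of "\<lambda>w. e \<bullet> c \<sigma> w"] by auto
    have "proj_pt (c \<sigma> w) \<in> K \<sigma> \<inter> proj_plane e"
      using w c_nz[OF w(1), of \<sigma>] mem_proj_pt by (auto simp: K_def proj_plane_def PR3_def)
    then show "K \<sigma> \<inter> proj_plane e \<noteq> {}" by blast
  qed
  ultimately show ?thesis by (simp add: comps)
qed

end

theorem theorem6:
  fixes A B :: "real^4^4"
  assumes symA: "transpose A = A"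
    and symB: "transpose B = B"
    and f_nonzero: "pencil_poly A B \<noteq> 0"
    and two_pairs: "\<exists>z1 z2 :: complex.
        Im z1 \<noteq> 0 \<and> Im z2 \<noteq> 0 \<and> z1 \<noteq> z2 \<and> z1 \<noteq> cnj z2 \<and>
        poly (map_poly complex_of_real (pencil_poly A B)) z1 = 0 \<and>
        poly (map_poly complex_of_real (pencil_poly A B)) z2 = 0"
  shows "segre_1111 A B \<and> index_seq_const A B 2 \<and>
         card (QSIC_components A B) = 2 \<and>
         (\<forall>K \<in> QSIC_components A B. open_component K)"
proof -
  let ?p = "map_poly complex_of_real (pencil_poly A B)"
  obtain z1 z2 where z: "Im z1 \<noteq> 0" "Im z2 \<noteq> 0" "z1 \<noteq> z2" "z1 \<noteq> cnj z2" "poly ?p z1 = 0" "poly ?p z2 = 0"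
    using two_pairs by blast
  have inv: "invertible A" by (rule four_roots_imp_invertible[OF f_nonzero z])
  \<comment> \<open>From each conjugate pair the root in the upper half plane is taken. The two
    choices differ because \<open>z1\<close> is neither \<open>z2\<close> nor its conjugate.\<close>
  define x y where "x = (if Im z1 > 0 then z1 else cnj z1)" and "y = (if Im z2 > 0 then z2 else cnj z2)"
  have im: "Im x > 0" "Im y > 0" using z by (auto simp: x_def y_def)
  have xy: "x \<noteq> y" using z by (auto simp: x_def y_def complex_eq_iff)
  have "poly ?p (cnj z1) = 0" "poly ?p (cnj z2) = 0"
    using z real_poly_cnj_root_iff[of ?p] by (auto simp: coeff_map_poly)
  then have r: "poly ?p x = 0" "poly ?p y = 0" using z by (auto simp: x_def y_def)
  obtain u v where VA: "transpose (conj_frame u v) ** cmat A ** conj_frame u v = mat 1"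
    and VB: "transpose (conj_frame u v) ** cmat B ** conj_frame u v = cdiag (conj_pairs x y)"
    using pencil_eigenbasis[OF symA symB inv im xy r] by blast
  obtain a b where "pencil_coordinates A B x y a b"
    by (rule pencil_real_coordinates[OF VA VB im])
  then interpret pencil_coordinates A B x y a b .
  have pos: "det (l *\<^sub>R A - B) > 0" for l
    using det_pencil_pos[OF VA VB] im by simp
  have "Id_pencil A B l = 2" for l
  proof -
    have "transpose (l *\<^sub>R A - B) = l *\<^sub>R transpose A - transpose B"
      by (simp add: transpose_def vec_eq_iff)
    then have "transpose (l *\<^sub>R A - B) = l *\<^sub>R A - B" by (simp add: symA symB)
    moreover obtain p where "p \<noteq> 0" "p \<bullet> ((l *\<^sub>R A - B) *v p) = 0"
      using isotropic_vector by blast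
    ultimately show ?thesis
      unfolding Id_pencil_def using pos by (intro num_pos_eig_eq_2)
  qed
  moreover have "poly (pencil_poly A B) l \<noteq> 0" for l
    using pos[of l] by (simp add: poly_pencil_poly)
  ultimately have "index_seq_const A B 2" by (simp add: index_seq_const_def)
  moreover have "segre_1111 A B"
    by (rule segre_1111_of_eigenbasis[OF inv VA VB inj_conj_pairs[OF im xy]])
  ultimately show ?thesis using QSIC_two_open_components by blast
qed

end
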